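(* Let $n \geq 1$ be an integer and suppose $\mathbb{Z}$ is a three-dimensional real polyhedral Banach space such that its unit sphere $S_{\mathbb{Z}}$ is a right prism having a regular $(4n+2)$-gon as its base, with coordinates on $\mathbb{Z} = \mathbb{R}^3$ chosen so that the vertices of $B_{\mathbb{Z}}$ are $(\cos\frac{2\pi j}{4n+2}, \sin\frac{2\pi j}{4n+2}, \pm 1)$, $j = 0, 1, \dots, 4n+1$. Then $z \in S_{\mathbb{Z}}$ is a left-symmetric point in $\mathbb{Z}$ if and only if it is either the centroid of a horizontal facet of $S_{\mathbb{Z}}$ or of the form $(x,y,0)$. Also, $z \in S_{\mathbb{Z}}$ is a right-symmetric point in $\mathbb{Z}$ if and only if it lies on a horizontal edge of $S_{\mathbb{Z}}$.
   Context: For a real Banach space $\mathbb{Z}$, $B_{\mathbb{Z}} = \{z \in \mathbb{Z} : \|z\| \leq 1\}$ and $S_{\mathbb{Z}} = \{z \in \mathbb{Z} : \|z\| = 1\}$; $\mathbb{Z}$ is polyhedral if $B_{\mathbb{Z}}$ has only finitely many extreme points. The unit ball $B_{\mathbb{Z}}$ is the convex hull of the listed vertices. The horizontal facets of $S_{\mathbb{Z}}$ are the two $(4n+2)$-gonal facets lying in the planes where the third coordinate equals $1$ and $-1$. The horizontal edges are the edges of $S_{\mathbb{Z}}$ parallel to the plane where the third coordinate is $0$, i.e. the (closed) edges bounding the two horizontal facets. For $x,y \in \mathbb{Z}$, $x$ is Birkhoff-James orthogonal to $y$, written $x \perp_B y$, if $\|x+\lambda y\| \geq \|x\|$ for all $\lambda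 \in \mathbb{R}$. An element $x \in \mathbb{Z}$ is a left-symmetric point in $\mathbb{Z}$ if for every $y \in \mathbb{Z}$, $x \perp_B y$ implies $y \perp_B x$; it is a right-symmetric point in $\mathbb{Z}$ if for every $y \in \mathbb{Z}$, $y \perp_B x$ implies $x \perp_B y$. *)

theory Defs
  imports "HOL-Analysis.Analysis"
begin

definition bj_orthogonal :: "'a::real_normed_vector \<Rightarrow> 'a \<Rightarrow> bool"  (infix \<open>\<bottom>\<^sub>B\<close> 50)
  where "x \<bottom>\<^sub>B y \<longleftrightarrow> (\<forall>c::real. norm (x + c *\<^sub>R y) \<ge> norm x)"

definition left_symmetric_point :: "'a::real_normed_vector \<Rightarrow> bool"
  where "left_symmetric_point x \<longleftrightarrow> (\<forall>y. x \<bottom>\<^sub>B y \<longrightarrow> y \<bottom>\<^sub>B x)"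

definition right_symmetric_point :: "'a::real_normed_vector \<Rightarrow> bool"
  where "right_symmetric_point x \<longleftrightarrow> (\<forall>y. y \<bottom>\<^sub>B x \<longrightarrow> x \<bottom>\<^sub>B y)"

definition prism_vertices :: "nat \<Rightarrow> (real^3) set"
  where "prism_vertices n =
    {vector [cos (2 * pi * real j / real (4 * n + 2)), sin (2 * pi * real j / real (4 * n + 2)), s]
      | j s. j \<in> {0..4 * n + 1} \<and> s \<in> {1, -1}}"

text \<open>
  Facets and edges of the unit sphere are the two- and one-dimensional faces of the unit ball
  \<open>B\<close>, taken here in coordinates. They are closed sets.
\<close>

definition horizontal_facet_of :: "(real^3) set \<Rightarrow> (real^3) set \<Rightarrow> bool"
    (infixr \<open>horizontal'_facet'_of\<close> 50)
  where "F horizontal_facet_of B \<longleftrightarrow>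
    F facet_of B \<and> (F \<subseteq> {p. p $ 3 = 1} \<or> F \<subseteq> {p. p $ 3 = -1})"

definition horizontal_edge_of :: "(real^3) set \<Rightarrow> (real^3) set \<Rightarrow> bool"
    (infixr \<open>horizontal'_edge'_of\<close> 50)
  where "E horizontal_edge_of B \<longleftrightarrow> E edge_of B \<and> (\<forall>p\<in>E. \<forall>q\<in>E. p $ 3 = q $ 3)"

definition centroid :: "'a::euclidean_space set \<Rightarrow> 'a"
  where "centroid S = (1 / measure lebesgue S) *\<^sub>R integral S (\<lambda>p. p)"

definition horizontal_proj :: "real^3 \<Rightarrow> real^2"
  where "horizontal_proj p = vector [p $ 1, p $ 2]"

text \<open>
  A facet is a null set of the three-dimensional Lebesgue measure, so its centroid is taken with
  respect to area. On a horizontal plane \<open>horizontal_proj\<close> is an isometry onto the Euclidean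
  plane, which reduces the centroid of a horizontal facet to that of a planar region.
\<close>

definition is_centroid_of_horizontal_facet :: "real^3 \<Rightarrow> (real^3) set \<Rightarrow> bool"
  where "is_centroid_of_horizontal_facet p F \<longleftrightarrow>
    p \<in> affine hull F \<and> horizontal_proj p = centroid (horizontal_proj ` F)"

end

theory Submission
  imports Defs
begin

text \<open>
  The norm on \<open>Z\<close> is the maximum of a polygonal norm \<open>N\<close> on the plane and the absolute value of the
  height. Since half the number \<open>4n + 2\<close> of sides is odd, a quarter turn carries the dual polygon to
  a multiple of the polygon, so \<open>N x\<close> is, up to a constant \<open>k\<close>, the largest area form \<open>\<omega>(w, x)\<close> with
  \<open>N w = 1\<close>. Hence \<open>x\<close> is orthogonal to \<open>y\<close> in the plane iff \<open>k |\<omega>(x, y)| = N x N y\<close>, a symmetric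
  condition, and also the one-sided version of orthogonality is symmetric on unit vectors. In the
  sum with the line, a vector whose plane part strictly dominates is orthogonal to another iff the
  plane parts are, and a vector whose height strictly dominates is orthogonal only to horizontal
  vectors. Both symmetries then reduce to comparing plane part and height.
\<close>

section \<open>Planes with symmetric orthogonality\<close>

text \<open>The determinant of \<open>x\<close> and \<open>y\<close>, the area form written as omega
  in the overview.\<close>

definition cross2 :: "complex \<Rightarrow> complex \<Rightarrow> real"
  where "cross2 x y = Re x * Im y - Im x * Re y"

lemma cross2_simps [simp]:
  "cross2 x (y + z) = cross2 x y + cross2 x z"
  "cross2 x (y - z) = cross2 x y - cross2 x z"
  "cross2 x (c *\<^sub>R y) = c * cross2 x y"
  "cross2 (x + z) y = cross2 x y + cross2 z y"
  "cross2 (c *\<^sub>R x) y = c * cross2 x y"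
  "cross2 x (- y) = - cross2 x y"
  "cross2 x x = 0" "cross2 x 0 = 0" "cross2 0 x = 0"
  by (auto simp: cross2_def algebra_simps)

lemma cross2_swap: "cross2 x y = - cross2 y x"
  by (simp add: cross2_def)

text \<open>Cramer's rule. With \<open>w\<close> and \<open>y\<close> independent it exhibits a
  point on the line through \<open>x\<close> in direction \<open>y\<close> as a multiple of
  \<open>w\<close>.\<close>

lemma cross2_cramer:
  "cross2 w y *\<^sub>R x + cross2 x w *\<^sub>R y = cross2 x y *\<^sub>R w"
  by (simp add: cross2_def complex_eq_iff algebra_simps)

text \<open>These are Radon planes. The assumptions say that the functionals
  \<open>k * cross2 w\<close> with \<open>N w = 1\<close> have norm at most 1 and suffice to norm
  every vector; that \<open>N\<close> is a norm is derived from this below.\<close>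

locale radon_plane =
  fixes N :: "complex \<Rightarrow> real" and k :: real
  assumes k_pos: "k > 0"
    and cross2_le: "k * \<bar>cross2 x y\<bar> \<le> N x * N y"
    and cross2_attained: "\<exists>w. N w = 1 \<and> k * cross2 w x = N x"
begin

lemma N_nonneg: "N x \<ge> 0"
proof -
  obtain w where w: "N w = 1" "k * cross2 w x = N x" using cross2_attained by blast
  have "0 \<le> k * \<bar>cross2 w x\<bar>" using k_pos by simp
  with cross2_le[of w x] w show ?thesis by simp
qed

lemma cross2_le_N:
  assumes "N w = 1"
  shows "k * cross2 w x \<le> N x"
proof -
  have "k * cross2 w x \<le> k * \<bar>cross2 w x\<bar>" using k_pos by (intro mult_left_mono) auto
  then show ?thesis using cross2_le[of w x] assms by simp
qed

lemma N_scale_le: "N (c *\<^sub>R x) \<le> \<bar>c\<bar> * N x"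
proof -
  obtain w where w: "N w = 1" "k * cross2 w (c *\<^sub>R x) = N (c *\<^sub>R x)"
    using cross2_attained by blast
  have "N (c *\<^sub>R x) = c * (k * cross2 w x)" using w(2) by (simp add: ac_simps)
  also have "\<dots> \<le> \<bar>c\<bar> * (k * \<bar>cross2 w x\<bar>)"
    using k_pos abs_ge_self[of "c * (k * cross2 w x)"] by (simp add: abs_mult)
  also have "\<dots> \<le> \<bar>c\<bar> * N x" using cross2_le[of w x] w by (intro mult_left_mono) auto
  finally show ?thesis .
qed

lemma N_0 [simp]: "N 0 = 0"
  using N_scale_le[of 0 0] N_nonneg[of 0] by simp

lemma N_scale [simp]: "N (c *\<^sub>R x) = \<bar>c\<bar> * N x"
proof (cases "c = 0")
  case False
  have "N x = N (inverse c *\<^sub>R (c *\<^sub>R x))" using False by simp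
  also have "\<dots> \<le> inverse \<bar>c\<bar> * N (c *\<^sub>R x)"
    unfolding abs_inverse[symmetric] by (rule N_scale_le)
  finally have "\<bar>c\<bar> * N x \<le> N (c *\<^sub>R x)" using False by (simp add: field_simps)
  with N_scale_le[of c x] show ?thesis by simp
qed simp

lemma N_minus [simp]: "N (- x) = N x"
  using N_scale[of "-1" x] by simp

lemma N_triangle: "N (x + y) \<le> N x + N y"
proof -
  obtain w where w: "N w = 1" "k * cross2 w (x + y) = N (x + y)" using cross2_attained by blast
  then show ?thesis using cross2_le_N[of w x] cross2_le_N[of w y] by (simp add: algebra_simps)
qed

lemma N_eq_0 [simp]: "N x = 0 \<longleftrightarrow> x = 0"
proof
  assume "N x = 0"
  then have "cross2 x y = 0" for y
    using cross2_le[of x y] k_pos by (simp add: mult_le_0_iff)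
  from this[of 1] this[of \<i>] show "x = 0" by (simp add: cross2_def complex_eq_iff)
qed simp

text \<open>Convexity along a line: a strict drop at step \<open>c\<close> persists at every shorter
  step \<open>d * c\<close>, so steps can be shortened until other quantities stay under
  control.\<close>

lemma N_segment_less:
  assumes "N x \<le> r" "N (x + c *\<^sub>R y) < r" "0 < d" "d \<le> 1"
  shows "N (x + (d * c) *\<^sub>R y) < r"
proof -
  have "x + (d * c) *\<^sub>R y = (1 - d) *\<^sub>R x + d *\<^sub>R (x + c *\<^sub>R y)" by (simp add: algebra_simps)
  then have "N (x + (d * c) *\<^sub>R y) \<le> (1 - d) * N x + d * N (x + c *\<^sub>R y)"
    using N_triangle[of "(1 - d) *\<^sub>R x" "d *\<^sub>R (x + c *\<^sub>R y)"] assms by simp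
  also have "\<dots> < (1 - d) * r + d * r"
    using assms by (intro add_le_less_mono mult_left_mono mult_strict_left_mono) auto
  finally show ?thesis by (simp add: algebra_simps)
qed

text \<open>Move along the line \<open>x + c y\<close> until it meets the direction \<open>w\<close> conjugate to \<open>y\<close>.\<close>

lemma ex_line_cross2: "\<exists>c. N (x + c *\<^sub>R y) * N y = k * \<bar>cross2 x y\<bar>"
proof (cases "y = 0")
  case False
  obtain w where w: "N w = 1" "k * cross2 w y = N y" using cross2_attained by blast
  have pos: "cross2 w y > 0"
  proof -
    have "0 < k * cross2 w y" using False w(2) N_nonneg[of y] by (simp add: less_le)
    then show ?thesis using k_pos by (simp add: zero_less_mult_iff)
  qed
  have "x + (cross2 x w / cross2 w y) *\<^sub>R y
      = inverse (cross2 w y) *\<^sub>R (cross2 w y *\<^sub>R x + cross2 x w *\<^sub>R y)"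
    using pos by (simp add: algebra_simps divide_inverse)
  also have "\<dots> = (cross2 x y / cross2 w y) *\<^sub>R w"
    by (simp only: cross2_cramer) (simp add: divide_inverse mult.commute)
  finally have "N (x + (cross2 x w / cross2 w y) *\<^sub>R y) * N y
      = \<bar>cross2 x y\<bar> / cross2 w y * (k * cross2 w y)" using w pos by simp
  also have "\<dots> = k * \<bar>cross2 x y\<bar>" using pos by simp
  finally show ?thesis by blast
qed simp

text \<open>The area form is constant along the line, so \<open>k * \<bar>cross2 x y\<bar>\<close>
  bounds \<open>N (x + c *\<^sub>R y) * N y\<close> from below, and \<open>ex_line_cross2\<close>
  shows that this minimum is attained. Orthogonality says that it is attained at
  \<open>c = 0\<close>.\<close>

lemma plane_orthogonal_iff: "(\<forall>c. N x \<le> N (x + c *\<^sub>R y)) \<longleftrightarrow> k * \<bar>cross2 x y\<bar> = N x * N y"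
proof
  assume *: "\<forall>c. N x \<le> N (x + c *\<^sub>R y)"
  obtain c where "N (x + c *\<^sub>R y) * N y = k * \<bar>cross2 x y\<bar>" using ex_line_cross2 by blast
  then have "N x * N y \<le> k * \<bar>cross2 x y\<bar>" using * N_nonneg[of y] mult_right_mono[of "N x" "N (x + c *\<^sub>R y)" "N y"] by simp
  with cross2_le[of x y] show "k * \<bar>cross2 x y\<bar> = N x * N y" by simp
next
  assume *: "k * \<bar>cross2 x y\<bar> = N x * N y"
  show "\<forall>c. N x \<le> N (x + c *\<^sub>R y)"
  proof (cases "y = 0")
    case False
    then have "N y > 0" using N_nonneg[of y] by (simp add: less_le)
    moreover have "N x * N y \<le> N (x + c *\<^sub>R y) * N y" for c
      using cross2_le[of "x + c *\<^sub>R y" y] * by simp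
    ultimately show ?thesis by simp
  qed simp
qed

lemma plane_orthogonal_sym:
  "(\<forall>c. N x \<le> N (x + c *\<^sub>R y)) \<longleftrightarrow> (\<forall>c. N y \<le> N (y + c *\<^sub>R x))"
  unfolding plane_orthogonal_iff by (subst cross2_swap) (simp add: mult.commute)

text \<open>Needed when plane part and height tie, since the height then controls only one side of
  the line. The argument splits on the sign at \<open>v\<close> of a functional norming
  \<open>u\<close>: nonnegative gives full orthogonality, negative gives the bound directly.\<close>

lemma plane_half_orthogonal_sym:
  assumes u: "N u = 1" and v: "N v = 1" and vu: "\<And>e. e \<ge> 0 \<Longrightarrow> 1 \<le> N (v - e *\<^sub>R u)" and "e \<ge> 0"
  shows "1 \<le> N (u - e *\<^sub>R v)"
proof -
  obtain w where w: "N w = 1" "k * cross2 w u = 1" using cross2_attained[of u] u by auto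
  define a where "a = k * cross2 w v"
  show ?thesis
  proof (cases "a \<ge> 0")
    case True
    \<comment> \<open>The functional \<open>k * cross2 w\<close> vanishes at this point of the ray,
      which is therefore a multiple of \<open>w\<close>; its norm is at least 1 by
      \<open>vu\<close>, and this forces equality in \<open>cross2_le\<close>.\<close>
    have "v - a *\<^sub>R u = k *\<^sub>R (cross2 w u *\<^sub>R v + cross2 v w *\<^sub>R u)"
      using w by (simp add: a_def algebra_simps cross2_swap[of v w])
    also have "\<dots> = (k * cross2 v u) *\<^sub>R w" by (simp only: cross2_cramer) simp
    finally have "1 \<le> k * \<bar>cross2 v u\<bar>" using vu[OF True] w k_pos by (simp add: abs_mult)
    then have "k * \<bar>cross2 u v\<bar> = N u * N v"
      using cross2_le[of u v] u v cross2_swap[of u v] by simp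
    then have "1 \<le> N (u + (-e) *\<^sub>R v)" unfolding plane_orthogonal_iff[symmetric] using u by metis
    then show ?thesis by simp
  next
    case False
    have "1 \<le> 1 - e * a" using False \<open>e \<ge> 0\<close> by (simp add: mult_nonneg_nonpos)
    also have "\<dots> = k * cross2 w (u - e *\<^sub>R v)" using w by (simp add: a_def algebra_simps)
    finally show ?thesis using cross2_le_N[OF w(1)] by (meson order_trans)
  qed
qed

end

section \<open>The maximum sum with a line\<close>

text \<open>Plane part and height are kept as abstract maps; \<open>ex_point\<close> supplies
  vectors with prescribed values of both, from which counterexamples are built.\<close>

locale radon_prism = radon_plane N k for N :: "complex \<Rightarrow> real" and k :: real +
  fixes pl :: "'z::real_normed_vector \<Rightarrow> complex" and ht :: "'z \<Rightarrow> real"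
  assumes linear_pl: "linear pl" and linear_ht: "linear ht"
    and norm_eq: "norm x = max (N (pl x)) \<bar>ht x\<bar>"
    and ex_point: "\<exists>x. pl x = p \<and> ht x = t"
begin

lemma coords_simps [simp]:
  "pl (x + c *\<^sub>R y) = pl x + c *\<^sub>R pl y" "ht (x + c *\<^sub>R y) = ht x + c * ht y"
  using linear_pl linear_ht by (simp_all add: linear_add linear_scale)

section \<open>Orthogonality when plane part or height strictly dominates\<close>

lemma orthogonal_eq: "x \<bottom>\<^sub>B y \<longleftrightarrow>
    (\<forall>c. max (N (pl x)) \<bar>ht x\<bar> \<le> max (N (pl x + c *\<^sub>R pl y)) \<bar>ht x + c * ht y\<bar>)"
  by (simp add: bj_orthogonal_def norm_eq)

text \<open>Close to \<open>x\<close> the norm only sees the plane part, and by convexity a drop of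
  \<open>N\<close> anywhere on the line yields a drop arbitrarily close to \<open>x\<close>.\<close>

lemma orthogonal_plane_dominates:
  assumes "\<bar>ht x\<bar> < N (pl x)" "x \<bottom>\<^sub>B y"
  shows "N (pl x) \<le> N (pl x + c *\<^sub>R pl y)"
proof (rule ccontr)
  assume "\<not> ?thesis"
  then have c: "N (pl x + c *\<^sub>R pl y) < N (pl x)" by simp
  define q where "q = N (pl x) - \<bar>ht x\<bar>"
  \<comment> \<open>A step factor of at most 1 under which the height moves by less than the gap
    \<open>q\<close>.\<close>
  define d where "d = q / (q + \<bar>c * ht y\<bar> + 1)"
  have q: "q > 0" using assms by (simp add: q_def)
  then have den: "q + \<bar>c * ht y\<bar> + 1 > 0" by simp
  have d: "0 < d" "d \<le> 1" using q by (simp_all add: d_def)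
  have "d * \<bar>c * ht y\<bar> < q"
  proof -
    have "d * \<bar>c * ht y\<bar> = q * (\<bar>c * ht y\<bar> / (q + \<bar>c * ht y\<bar> + 1))" by (simp add: d_def)
    also have "\<dots> < q * 1" using q den by (intro mult_strict_left_mono) auto
    finally show ?thesis by simp
  qed
  moreover have "\<bar>(d * c) * ht y\<bar> = d * \<bar>c * ht y\<bar>" using d by (simp add: abs_mult)
  ultimately have "\<bar>ht x + (d * c) * ht y\<bar> < N (pl x)" unfolding q_def by linarith
  moreover have "N (pl x + (d * c) *\<^sub>R pl y) < N (pl x)" using N_segment_less[OF _ c d] by simp
  ultimately show False using assms(2)[unfolded orthogonal_eq, rule_format, of "d * c"] by linarith
qed

text \<open>Otherwise a short step towards the zero of the height lowers the height while the plane
  part stays below it, so the norm drops.\<close>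

lemma orthogonal_height_dominates:
  assumes "N (pl x) < \<bar>ht x\<bar>" "x \<bottom>\<^sub>B y"
  shows "ht y = 0"
proof (rule ccontr)
  assume s: "ht y \<noteq> 0"
  define c where "c = - ht x / ht y"
  define q where "q = \<bar>ht x\<bar> - N (pl x)"
  define d where "d = q / (q + N (c *\<^sub>R pl y) + 1)"
  have q: "q > 0" using assms by (simp add: q_def)
  have nn: "N (c *\<^sub>R pl y) \<ge> 0" by (rule N_nonneg)
  have d: "0 < d" "d \<le> 1" using q nn by (simp_all add: d_def add_pos_nonneg)
  have "d * N (c *\<^sub>R pl y) < q"
  proof -
    have "d * N (c *\<^sub>R pl y) = q * (N (c *\<^sub>R pl y) / (q + N (c *\<^sub>R pl y) + 1))" by (simp add: d_def)
    also have "\<dots> < q * 1" using q nn by (intro mult_strict_left_mono) auto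
    finally show ?thesis by simp
  qed
  moreover have "N ((d * c) *\<^sub>R pl y) = d * N (c *\<^sub>R pl y)" using d by (simp add: abs_mult)
  ultimately have "N (pl x + (d * c) *\<^sub>R pl y) < \<bar>ht x\<bar>"
    using N_triangle[of "pl x" "(d * c) *\<^sub>R pl y"] unfolding q_def by linarith
  moreover have "\<bar>ht x + (d * c) * ht y\<bar> < \<bar>ht x\<bar>"
  proof -
    have "ht x + (d * c) * ht y = (1 - d) * ht x" using s by (simp add: c_def algebra_simps)
    then have "\<bar>ht x + (d * c) * ht y\<bar> = (1 - d) * \<bar>ht x\<bar>" using d by (simp add: abs_mult)
    also have "\<dots> < 1 * \<bar>ht x\<bar>"
      using d assms N_nonneg[of "pl x"] by (intro mult_strict_right_mono) linarith+
    finally show ?thesis by simp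
  qed
  ultimately show False using assms(2)[unfolded orthogonal_eq, rule_format, of "d * c"] by linarith
qed

text \<open>If both parts of \<open>z\<close> are nonzero, the vector to test is vertical when the
  plane part has norm 1, and the plane part of \<open>z\<close> at height 0 when the height has
  modulus 1.\<close>

lemma left_symmetric_iff:
  assumes z: "norm z = 1"
  shows "left_symmetric_point z \<longleftrightarrow> pl z = 0 \<or> ht z = 0"
proof
  assume ls: "left_symmetric_point z"
  show "pl z = 0 \<or> ht z = 0"
  proof (rule ccontr)
    assume "\<not> ?thesis"
    then have u: "N (pl z) > 0" and t: "ht z \<noteq> 0" using N_nonneg[of "pl z"] by (auto simp: less_le)
    have z1: "max (N (pl z)) \<bar>ht z\<bar> = 1" using z norm_eq by simp
    consider "N (pl z) = 1" "\<bar>ht z\<bar> \<le> 1" | "\<bar>ht z\<bar> = 1" "N (pl z) \<le> 1" using z1 by linarith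
    then show False
    proof cases
      case 1
      obtain y where y: "pl y = 0" "ht y = 1" using ex_point by blast
      have "z \<bottom>\<^sub>B y" unfolding orthogonal_eq using 1 y by simp
      then have "y \<bottom>\<^sub>B z" using ls by (simp add: left_symmetric_point_def)
      \<comment> \<open>With \<open>c = - ht z / 2\<close> the plane part has norm
        \<open>\<bar>ht z\<bar> / 2\<close> and the height is \<open>1 - (ht z)^2 / 2\<close>, both
        below 1 in modulus.\<close>
      then have "1 \<le> max (\<bar>ht z / 2\<bar>) \<bar>1 - ht z / 2 * ht z\<bar>"
        unfolding orthogonal_eq using y 1 by (auto dest!: spec[of _ "- (ht z / 2)"])
      moreover have "0 < ht z * ht z" "ht z * ht z \<le> 1"
        using t 1 by (auto simp: zero_less_mult_iff abs_le_square_iff power2_eq_square[symmetric] abs_square_le_1)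
      ultimately show False using 1 by auto
    next
      case 2
      obtain y where y: "pl y = pl z" "ht y = 0" using ex_point by blast
      have "z \<bottom>\<^sub>B y" unfolding orthogonal_eq using 2 y by simp
      then have "y \<bottom>\<^sub>B z" using ls by (simp add: left_symmetric_point_def)
      \<comment> \<open>This \<open>c\<close> shrinks the plane part by the factor
        \<open>1 - N (pl z) / 2\<close> and creates a height of only half of
        \<open>N (pl z)\<close>.\<close>
      then have "N (pl z) \<le> max (N (pl z + (- (N (pl z) / 2)) *\<^sub>R pl z)) \<bar>N (pl z) / 2 * ht z\<bar>"
        unfolding orthogonal_eq using y by (auto dest!: spec[of _ "- (N (pl z) / 2)"])
      also have "pl z + (- (N (pl z) / 2)) *\<^sub>R pl z = (1 - N (pl z) / 2) *\<^sub>R pl z"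
        by (simp add: algebra_simps)
      also have "N \<dots> = (1 - N (pl z) / 2) * N (pl z)" using 2 by simp
      also have "\<bar>N (pl z) / 2 * ht z\<bar> = N (pl z) / 2" using 2 u by (simp add: abs_mult)
      finally have "N (pl z) \<le> (1 - N (pl z) / 2) * N (pl z)" using u by linarith
      then show False using mult_pos_pos[OF u u] by (simp add: algebra_simps)
    qed
  qed
next
  assume "pl z = 0 \<or> ht z = 0"
  then show "left_symmetric_point z"
  proof
    assume p: "pl z = 0"
    then have "\<bar>ht z\<bar> = 1" using z norm_eq[of z] by simp
    \<comment> \<open>Height dominates in \<open>z\<close>, so \<open>y\<close> is horizontal, and
      adding the vertical \<open>z\<close> leaves its plane part unchanged.\<close>
    then have h: "ht y = 0" if "z \<bottom>\<^sub>B y" for y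
      using orthogonal_height_dominates[OF _ that] p by simp
    have "y \<bottom>\<^sub>B z" if "z \<bottom>\<^sub>B y" for y
      unfolding orthogonal_eq using h[OF that] p N_nonneg[of "pl y"] by simp
    then show ?thesis by (simp add: left_symmetric_point_def)
  next
    assume h: "ht z = 0"
    then have N1: "N (pl z) = 1" using z norm_eq[of z] N_nonneg[of "pl z"] by (simp add: max_def split: if_splits)
    have "y \<bottom>\<^sub>B z" if "z \<bottom>\<^sub>B y" for y
    proof -
      \<comment> \<open>Plane orthogonality can be reversed, and adding multiples of the horizontal
        \<open>z\<close> to \<open>y\<close> does not change its height.\<close>
      have "\<forall>c. N (pl z) \<le> N (pl z + c *\<^sub>R pl y)"
        using orthogonal_plane_dominates[OF _ that] h N1 by simp
      then have "\<forall>c. N (pl y) \<le> N (pl y + c *\<^sub>R pl z)" by (simp add: plane_orthogonal_sym[of "pl z"])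
      then show ?thesis unfolding orthogonal_eq using h by (simp add: max.coboundedI1)
    qed
    then show ?thesis by (simp add: left_symmetric_point_def)
  qed
qed

text \<open>The substantial case is a tie in \<open>y\<close>: on the side where adding multiples of
  \<open>z\<close> lowers the height of \<open>y\<close>, its plane part must not drop. This is a
  one-sided orthogonality, reversed by \<open>plane_half_orthogonal_sym\<close>.\<close>

lemma right_symmetric_edge:
  assumes u: "N (pl z) = 1" and t: "\<bar>ht z\<bar> = 1"
  shows "right_symmetric_point z"
  unfolding right_symmetric_point_def
proof (intro allI impI)
  fix y assume yz: "y \<bottom>\<^sub>B z"
  consider "\<bar>ht y\<bar> < N (pl y)" | "N (pl y) < \<bar>ht y\<bar>" | "N (pl y) = \<bar>ht y\<bar>" by linarith
  then show "z \<bottom>\<^sub>B y"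
  proof cases
    case 1
    then have "\<forall>c. N (pl y) \<le> N (pl y + c *\<^sub>R pl z)" using orthogonal_plane_dominates yz by blast
    then have "\<forall>c. 1 \<le> N (pl z + c *\<^sub>R pl y)" unfolding plane_orthogonal_sym[of "pl y"] u .
    then show ?thesis unfolding orthogonal_eq using u t by (simp add: le_max_iff_disj)
  next
    case 2
    then have "ht z = 0" using orthogonal_height_dominates yz by blast
    then show ?thesis using t by simp
  next
    case 3
    define r where "r = N (pl y)"
    show ?thesis
    proof (cases "r = 0")
      case True
      then show ?thesis using 3 by (simp add: r_def orthogonal_eq)
    next
      case False
      then have r: "r > 0" using N_nonneg[of "pl y"] unfolding r_def by linarith
      \<comment> \<open>The relative sign of the two heights. It makes \<open>y\<close> equal to
        \<open>\<sigma> * r\<close> times the vector with plane part \<open>v\<close> and height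
        \<open>ht z\<close>, which reduces to equal heights.\<close>
      define \<sigma> where "\<sigma> = ht y * ht z / r"
      have t2: "ht z * ht z = 1" using t abs_mult_self_eq[of "ht z"] by simp
      have \<sigma>: "\<bar>\<sigma>\<bar> = 1" using r 3 t by (simp add: \<sigma>_def abs_mult r_def)
      then have \<sigma>2: "\<sigma> * \<sigma> = 1" using abs_mult_self_eq[of \<sigma>] by simp
      have s: "ht y = \<sigma> * r * ht z" using r t2 by (simp add: \<sigma>_def mult.assoc)
      define v where "v = (\<sigma> / r) *\<^sub>R pl y"
      have py: "pl y = (\<sigma> * r) *\<^sub>R v" using r \<sigma>2 by (simp add: v_def)
      have "N v = \<bar>\<sigma> / r\<bar> * r" unfolding v_def N_scale r_def ..
      then have Nv: "N v = 1" using r \<sigma> by simp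
      have "1 \<le> N (v - e *\<^sub>R pl z)" if "e \<ge> 0" for e
      proof (rule ccontr)
        assume "\<not> ?thesis"
        then have lt: "N (v + (-e) *\<^sub>R pl z) < 1" by simp
        have e: "e > 0" using lt Nv that by (cases "e = 0") auto
        \<comment> \<open>Then \<open>d * e < 1\<close>, so the shortened step shrinks the height
          strictly without changing its sign, and the plane part still drops.\<close>
        define d where "d = 1 / (1 + e)"
        have d: "0 < d" "d \<le> 1" "0 < d * e" "d * e < 1" using e by (auto simp: d_def)
        have less: "N (v + (d * (-e)) *\<^sub>R pl z) < 1" using N_segment_less[OF _ lt d(1,2)] Nv by simp
        define c where "c = - (\<sigma> * r * (d * e))"
        have "pl y + c *\<^sub>R pl z = (\<sigma> * r) *\<^sub>R (v + (d * (-e)) *\<^sub>R pl z)"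
          by (simp add: py c_def algebra_simps)
        then have "N (pl y + c *\<^sub>R pl z) = r * N (v + (d * (-e)) *\<^sub>R pl z)"
          using \<sigma> r by (simp add: abs_mult)
        then have 1: "N (pl y + c *\<^sub>R pl z) < r" using less r by simp
        have "ht y + c * ht z = (\<sigma> * r * ht z) * (1 - d * e)" by (simp add: s c_def algebra_simps)
        then have "\<bar>ht y + c * ht z\<bar> = r * (1 - d * e)" using \<sigma> t r d by (simp add: abs_mult)
        then have "\<bar>ht y + c * ht z\<bar> < r"
          using r d mult_strict_left_mono[of "1 - d * e" 1 r] by simp
        with 1 show False using yz[unfolded orthogonal_eq, rule_format, of c] 3 r_def by linarith
      qed
      note half = plane_half_orthogonal_sym[OF u Nv this]
      have "1 \<le> max (N (pl z + c *\<^sub>R pl y)) \<bar>ht z + c * ht y\<bar>" for c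
      \<comment> \<open>For a nonpositive coefficient the one-sided orthogonality bounds the plane
        part; for a positive one the height grows.\<close>
      proof (cases "c * \<sigma> * r \<le> 0")
        case True
        then have "1 \<le> N (pl z - (- (c * \<sigma> * r)) *\<^sub>R v)" using True half[of "- (c * \<sigma> * r)"] by linarith
        then show ?thesis by (simp add: py mult.assoc)
      next
        case False
        have "ht z + c * ht y = ht z * (1 + c * \<sigma> * r)" by (simp add: s algebra_simps)
        then have "\<bar>ht z + c * ht y\<bar> = \<bar>1 + c * \<sigma> * r\<bar>" using t by (simp add: abs_mult)
        with False show ?thesis by linarith
      qed
      then show ?thesis unfolding orthogonal_eq using u t by simp
    qed
  qed
qed

text \<open>Off the edges a vector \<open>y\<close> is built with
  \<open>y \<bottom>\<^sub>B z\<close> such that for either sign of the step one of its two parts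
  does not fall below 1, while the dominance lemmas exclude
  \<open>z \<bottom>\<^sub>B y\<close>.\<close>

lemma right_symmetric_iff:
  assumes z: "norm z = 1"
  shows "right_symmetric_point z \<longleftrightarrow> N (pl z) = 1 \<and> \<bar>ht z\<bar> = 1"
proof
  assume rs: "right_symmetric_point z"
  have z1: "max (N (pl z)) \<bar>ht z\<bar> = 1" using z norm_eq by simp
  show "N (pl z) = 1 \<and> \<bar>ht z\<bar> = 1"
  proof (rule ccontr)
    assume "\<not> ?thesis"
    then consider "N (pl z) = 1" "\<bar>ht z\<bar> < 1" | "\<bar>ht z\<bar> = 1" "N (pl z) < 1" using z1 by linarith
    then show False
    proof cases
      case 1
      \<comment> \<open>The sign opposite to \<open>ht z\<close>: positive multiples of
        \<open>z\<close> enlarge the plane part of \<open>y\<close>, negative ones do not bring the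
        height below 1 in modulus.\<close>
      define s :: real where "s = (if ht z \<ge> 0 then -1 else 1)"
      obtain y where y: "pl y = pl z" "ht y = s" using ex_point by blast
      have "1 \<le> max (N (pl z + c *\<^sub>R pl z)) \<bar>s + c * ht z\<bar>" for c
      proof (cases "c \<ge> 0")
        case True
        have "pl z + c *\<^sub>R pl z = (1 + c) *\<^sub>R pl z" by (simp add: algebra_simps)
        then have "N (pl z + c *\<^sub>R pl z) = 1 + c" using True 1 by simp
        with True show ?thesis by simp
      next
        case False
        then have "\<bar>s + c * ht z\<bar> \<ge> 1"
          by (cases "ht z \<ge> 0") (use mult_nonpos_nonneg[of c "ht z"] mult_nonpos_nonpos[of c "ht z"] in \<open>auto simp: s_def\<close>)
        then show ?thesis by simp
      qed
      then have "y \<bottom>\<^sub>B z" unfolding orthogonal_eq using y 1 by (simp add: s_def)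
      then have "z \<bottom>\<^sub>B y" using rs by (simp add: right_symmetric_point_def)
      from orthogonal_plane_dominates[OF _ this, of "-1"] 1 y show False by simp
    next
      case 2
      \<comment> \<open>The unit vector opposite to \<open>pl z\<close>, or any unit vector if
        \<open>pl z = 0\<close>. Positive multiples of \<open>z\<close> are handled by the
        height.\<close>
      obtain v where v: "N v = 1" "\<And>c. c \<le> 0 \<Longrightarrow> 1 \<le> N (v + c *\<^sub>R pl z)"
      proof (cases "pl z = 0")
        case True
        then show ?thesis using that cross2_attained[of 0] by auto
      next
        case False
        then have pos: "N (pl z) > 0" using N_nonneg[of "pl z"] by (simp add: less_le)
        have "1 \<le> N ((- 1 / N (pl z)) *\<^sub>R pl z + c *\<^sub>R pl z)" if "c \<le> 0" for c
        proof -
          have "(- 1 / N (pl z)) *\<^sub>R pl z + c *\<^sub>R pl z = (- (1 / N (pl z) - c)) *\<^sub>R pl z"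
            by (simp add: algebra_simps)
          also have "N \<dots> = \<bar>1 / N (pl z) - c\<bar> * N (pl z)" by (simp only: N_scale abs_minus_cancel)
          also have "\<bar>1 / N (pl z) - c\<bar> = 1 / N (pl z) - c"
            using divide_pos_pos[of 1 "N (pl z)"] pos that by linarith
          also have "\<dots> * N (pl z) \<ge> 1" using pos that False by (simp add: algebra_simps mult_nonneg_nonpos mult_nonpos_nonneg)
          finally show ?thesis .
        qed
        moreover have "N ((- 1 / N (pl z)) *\<^sub>R pl z) = 1" using pos False by simp
        ultimately show ?thesis using that by blast
      qed
      obtain y where y: "pl y = v" "ht y = ht z" using ex_point by blast
      have "1 \<le> max (N (v + c *\<^sub>R pl z)) \<bar>ht z + c * ht z\<bar>" for c
      proof (cases "c \<le> 0")
        case True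
        then show ?thesis using v by (simp add: le_max_iff_disj)
      next
        case False
        have "ht z + c * ht z = (1 + c) * ht z" by (simp add: algebra_simps)
        then have "\<bar>ht z + c * ht z\<bar> = 1 + c" using False 2 by (simp add: abs_mult)
        with False show ?thesis by simp
      qed
      then have "y \<bottom>\<^sub>B z" unfolding orthogonal_eq using y v 2 by simp
      then have "z \<bottom>\<^sub>B y" using rs by (simp add: right_symmetric_point_def)
      from orthogonal_height_dominates[OF _ this] 2 y show False by simp
    qed
  qed
qed (use right_symmetric_edge in blast)

end

section \<open>Regular polygons\<close>

lemma cross2_cis: "cross2 (cis a) (cis b) = sin (b - a)"
  by (simp add: cross2_def sin_diff)

locale regular_polygon =
  fixes n :: nat
  assumes n: "n \<ge> 1"
begin

text \<open>Half the central angle of a side, so \<open>cos \<alpha>\<close> is the inradius of the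
  polygon.\<close>

definition half_angle :: real
  where "half_angle = pi / real (4 * n + 2)"

abbreviation \<alpha> :: real
  where "\<alpha> \<equiv> half_angle"

text \<open>Indexing by all integers lets neighbours, antipodes and conjugate vertices be reached by
  plain shifts.\<close>

definition vertex :: "int \<Rightarrow> complex"
  where "vertex j = cis (2 * of_int j * \<alpha>)"

text \<open>The gauge of the polygon. \<open>cross2 w\<close> is the inner product with
  \<open>w\<close> turned by a right angle, an odd multiple of \<open>\<alpha>\<close>, so vertices
  turn into edge normals; dividing by the inradius normalises them.\<close>

definition polygon_norm :: "complex \<Rightarrow> real"
  where "polygon_norm x = Max ((\<lambda>w. cross2 w x) ` range vertex) / cos \<alpha>"

lemma pi_eq: "pi = (4 * real n + 2) * \<alpha>"
  by (simp add: half_angle_def field_simps)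

lemma \<alpha>_pos: "\<alpha> > 0"
  by (simp add: half_angle_def)

lemma two_\<alpha>_less: "2 * \<alpha> < pi / 2"
proof -
  have "4 < 4 * real n + 2" using n by linarith
  then have "4 * \<alpha> < (4 * real n + 2) * \<alpha>" using \<alpha>_pos by (rule mult_strict_right_mono)
  then show ?thesis using pi_eq by simp
qed

lemma cos_\<alpha>_pos: "cos \<alpha> > 0"
  using \<alpha>_pos two_\<alpha>_less by (intro cos_gt_zero) auto

lemma sin_two_\<alpha>_pos: "sin (2 * \<alpha>) > 0"
  using \<alpha>_pos two_\<alpha>_less by (intro sin_gt_zero) auto

lemma cross2_vertex: "cross2 (vertex i) (vertex j) = sin (2 * of_int (j - i) * \<alpha>)"
  by (simp add: vertex_def cross2_cis algebra_simps)

lemma vertex_mod: "vertex (j mod (4 * int n + 2)) = vertex j"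
proof -
  let ?m = "4 * int n + 2"
  have "of_int j = of_int (j mod ?m) + of_int (j div ?m) * (4 * real n + 2)"
    using arg_cong[OF div_mult_mod_eq[of j ?m], of real_of_int]
    unfolding of_int_add[of "_ * _"] of_int_mult[of "_ div _"] by (simp add: add.commute)
  then have "2 * of_int j * \<alpha> = 2 * of_int (j mod ?m) * \<alpha> + 2 * pi * of_int (j div ?m)"
    by (subst pi_eq) (simp add: algebra_simps)
  moreover have "cis (2 * pi * of_int (j div ?m)) = 1" by (rule cis_multiple_2pi) simp
  ultimately show ?thesis by (simp add: vertex_def flip: cis_mult)
qed

lemma range_vertex: "range vertex = vertex ` {0..4 * int n + 1}"
proof
  show "range vertex \<subseteq> vertex ` {0..4 * int n + 1}"
  proof
    fix v assume "v \<in> range vertex"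
    then obtain j where "v = vertex j" by blast
    then have "v = vertex (j mod (4 * int n + 2))" by (simp add: vertex_mod)
    moreover have "j mod (4 * int n + 2) \<in> {0..4 * int n + 1}"
      using pos_mod_bound[of "4 * int n + 2" j] by (simp del: pos_mod_bound)
    ultimately show "v \<in> vertex ` {0..4 * int n + 1}" by blast
  qed
qed auto

lemma finite_range_vertex: "finite (range vertex)"
  by (simp add: range_vertex)

lemma vertex_antipodal: "vertex (j + (2 * int n + 1)) = - vertex j"
proof -
  have "2 * of_int (j + (2 * int n + 1)) * \<alpha> = 2 * of_int j * \<alpha> + pi"
    by (subst pi_eq) (simp add: algebra_simps)
  then show ?thesis by (simp add: vertex_def flip: cis_mult)
qed

text \<open>The value is the sine of an even multiple of \<open>\<alpha>\<close>, whereas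
  \<open>pi / 2\<close> is the odd multiple \<open>2 * n + 1\<close>. Hence the angle misses
  \<open>pi / 2\<close> by at least \<open>\<alpha>\<close>.\<close>

lemma cross2_vertex_le: "cross2 (vertex i) (vertex j) \<le> cos \<alpha>"
proof -
  define d where "d = (j - i) mod (4 * int n + 2)"
  have "cross2 (vertex i) (vertex j) = cross2 (vertex 0) (vertex (j - i))"
    by (simp add: cross2_vertex)
  also have "\<dots> = cross2 (vertex 0) (vertex d)" by (simp add: d_def vertex_mod)
  also have "\<dots> = sin (2 * of_int d * \<alpha>)" by (simp add: cross2_vertex)
  also have "\<dots> \<le> cos \<alpha>"
  proof (cases "d \<le> 2 * int n")
    case True
    have d0: "d \<ge> 0" by (simp add: d_def)
    \<comment> \<open>The distance from the angle to \<open>pi / 2\<close> in units of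
      \<open>\<alpha>\<close>; it is odd and therefore at least 1.\<close>
    define m where "m = \<bar>2 * int n + 1 - 2 * d\<bar>"
    have m: "1 \<le> m" "m \<le> 2 * int n + 1" using True d0 unfolding m_def by presburger+
    have half: "pi / 2 = (2 * real n + 1) * \<alpha>" using pi_eq by (simp add: algebra_simps)
    have "sin (2 * of_int d * \<alpha>) = cos (pi / 2 - 2 * of_int d * \<alpha>)" by (simp add: cos_sin_eq)
    also have "pi / 2 - 2 * of_int d * \<alpha> = of_int (2 * int n + 1 - 2 * d) * \<alpha>"
      by (simp add: half algebra_simps)
    also have "cos \<dots> = cos (of_int m * \<alpha>)"
      unfolding m_def of_int_abs using \<alpha>_pos cos_abs_real[of "of_int (2 * int n + 1 - 2 * d) * \<alpha>"]
      by (simp only: abs_mult abs_of_pos)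
    also have "\<dots> \<le> cos \<alpha>"
    proof (rule cos_monotone_0_pi_le)
      have "1 * \<alpha> \<le> of_int m * \<alpha>" using m \<alpha>_pos by (intro mult_right_mono) auto
      then show "\<alpha> \<le> of_int m * \<alpha>" by simp
      have "of_int m \<le> 2 * real n + 1" using m(2) by linarith
      then have "of_int m * \<alpha> \<le> (2 * real n + 1) * \<alpha>" using \<alpha>_pos by (intro mult_right_mono) auto
      then show "of_int m * \<alpha> \<le> pi" using half pi_gt_zero by linarith
    qed (use \<alpha>_pos in simp)
    finally show ?thesis .
  next
    case False
    have "of_int d \<ge> 2 * real n + 1" using False by linarith
    then have 1: "pi \<le> 2 * of_int d * \<alpha>"
      using mult_right_mono[of "2 * real n + 1" "of_int d" "\<alpha>"] \<alpha>_pos by (subst pi_eq) (simp add: algebra_simps)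
    have "d < 4 * int n + 2" by (simp add: d_def)
    then have "of_int d \<le> 4 * real n + 2" by linarith
    then have 2: "2 * of_int d * \<alpha> \<le> 2 * pi"
      using mult_right_mono[of "of_int d" "4 * real n + 2" "\<alpha>"] \<alpha>_pos by (subst pi_eq) (simp add: algebra_simps)
    have "0 \<le> sin (2 * of_int d * \<alpha> - pi)" using 1 2 by (intro sin_ge_zero) auto
    then have "sin (2 * of_int d * \<alpha>) \<le> 0" by (simp add: sin_diff)
    then show ?thesis using cos_\<alpha>_pos by linarith
  qed
  finally show ?thesis .
qed

text \<open>The vertex \<open>j - n\<close> yields the functional of the side from vertex
  \<open>j\<close> to vertex \<open>j + 1\<close>: the angles to its endpoints are
  \<open>pi / 2 - \<alpha>\<close> and \<open>pi / 2 + \<alpha>\<close>.\<close>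

lemma cross2_vertex_conj: "cross2 (vertex (j - int n)) (vertex j) = cos \<alpha>"
  "cross2 (vertex (j - int n)) (vertex (j + 1)) = cos \<alpha>"
proof -
  have "2 * real n * \<alpha> = pi / 2 - \<alpha>" using pi_eq by (simp add: algebra_simps)
  then show "cross2 (vertex (j - int n)) (vertex j) = cos \<alpha>"
    by (simp add: cross2_vertex sin_diff)
  have "2 * (1 + real n) * \<alpha> = pi / 2 + \<alpha>" using pi_eq by (simp add: algebra_simps)
  then show "cross2 (vertex (j - int n)) (vertex (j + 1)) = cos \<alpha>"
    by (simp add: cross2_vertex sin_add)
qed

section \<open>The polygonal norm on the sectors spanned by neighbouring vertices\<close>

lemma polygon_norm_ge: "cross2 (vertex j) x \<le> cos \<alpha> * polygon_norm x"
proof -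
  have "cross2 (vertex j) x \<le> Max ((\<lambda>w. cross2 w x) ` range vertex)"
    using finite_range_vertex by (intro Max_ge) auto
  then show ?thesis using cos_\<alpha>_pos by (simp add: polygon_norm_def)
qed

lemma polygon_norm_attained: "\<exists>j. cross2 (vertex j) x = cos \<alpha> * polygon_norm x"
proof -
  have "Max ((\<lambda>w. cross2 w x) ` range vertex) \<in> (\<lambda>w. cross2 w x) ` range vertex"
    using finite_range_vertex by (intro Max_in) auto
  then show ?thesis using cos_\<alpha>_pos by (auto simp: polygon_norm_def)
qed

text \<open>The vertex bounds give the upper estimate, and the functional of the side from
  \<open>j\<close> to \<open>j + 1\<close> attains it.\<close>

lemma polygon_norm_sector:
  assumes "a \<ge> 0" "b \<ge> 0"
  shows "polygon_norm (a *\<^sub>R vertex j + b *\<^sub>R vertex (j + 1)) = a + b" (is "polygon_norm ?x = _")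
proof -
  obtain i where "cross2 (vertex i) ?x = cos \<alpha> * polygon_norm ?x"
    using polygon_norm_attained by blast
  moreover have "cross2 (vertex i) ?x \<le> a * cos \<alpha> + b * cos \<alpha>"
    unfolding cross2_simps using assms by (intro add_mono mult_left_mono cross2_vertex_le)
  ultimately have "cos \<alpha> * polygon_norm ?x \<le> cos \<alpha> * (a + b)" by (simp add: algebra_simps)
  moreover have "cos \<alpha> * (a + b) \<le> cos \<alpha> * polygon_norm ?x"
    using polygon_norm_ge[of "j - int n" ?x]
    unfolding cross2_simps cross2_vertex_conj by (simp add: ring_distribs mult.commute)
  ultimately show ?thesis using cos_\<alpha>_pos by simp
qed

lemma polygon_norm_vertex: "polygon_norm (vertex j) = 1"
  using polygon_norm_sector[of 1 0 j] by simp

lemma ex_sector: "\<exists>j a b. a \<ge> 0 \<and> b \<ge> 0 \<and> x = a *\<^sub>R vertex j + b *\<^sub>R vertex (j + 1)"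
proof -
  define j where "j = \<lfloor>Arg x / (2 * \<alpha>)\<rfloor>"
  define \<phi> where "\<phi> = Arg x - 2 * of_int j * \<alpha>"
  have 1: "of_int j \<le> Arg x / (2 * \<alpha>)" unfolding j_def by (rule of_int_floor_le)
  have 2: "Arg x / (2 * \<alpha>) < of_int j + 1" unfolding j_def by linarith
  have 3: "of_int j * (2 * \<alpha>) \<le> Arg x" using 1 \<alpha>_pos by (simp add: pos_le_divide_eq)
  have 4: "Arg x < (of_int j + 1) * (2 * \<alpha>)" using 2 \<alpha>_pos by (simp add: pos_divide_less_eq)
  have \<phi>: "0 \<le> \<phi>" "\<phi> < 2 * \<alpha>" using 3 4 by (simp_all add: \<phi>_def algebra_simps)
  \<comment> \<open>The coefficients come from the sine rule in the sector of angle
    \<open>2 * \<alpha>\<close> containing \<open>x\<close>, with \<open>\<phi>\<close> the angle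
    from its first ray.\<close>
  define a where "a = norm x * (sin (2 * \<alpha> - \<phi>) / sin (2 * \<alpha>))"
  define b where "b = norm x * (sin \<phi> / sin (2 * \<alpha>))"
  have "sin \<phi> \<ge> 0" "sin (2 * \<alpha> - \<phi>) \<ge> 0" using \<phi> \<alpha>_pos two_\<alpha>_less
    by (auto intro!: sin_ge_zero)
  then have ab: "a \<ge> 0" "b \<ge> 0" using sin_two_\<alpha>_pos by (auto simp: a_def b_def)
  have "sin (2 * \<alpha>) *\<^sub>R cis \<phi> = sin (2 * \<alpha> - \<phi>) *\<^sub>R 1 + sin \<phi> *\<^sub>R cis (2 * \<alpha>)"
    by (simp add: complex_eq_iff sin_diff)
  then have "(norm x / sin (2 * \<alpha>)) *\<^sub>R (vertex j * (sin (2 * \<alpha>) *\<^sub>R cis \<phi>)) =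
      (norm x / sin (2 * \<alpha>)) *\<^sub>R (vertex j * (sin (2 * \<alpha> - \<phi>) *\<^sub>R 1 + sin \<phi> *\<^sub>R cis (2 * \<alpha>)))"
    by (rule arg_cong)
  then have "norm x *\<^sub>R (vertex j * cis \<phi>) = a *\<^sub>R vertex j + b *\<^sub>R (vertex j * cis (2 * \<alpha>))"
    using sin_two_\<alpha>_pos by (simp add: a_def b_def scaleR_add_right ring_distribs)
  moreover have "vertex j * cis \<phi> = cis (Arg x)" by (simp add: vertex_def cis_mult \<phi>_def)
  moreover have "vertex j * cis (2 * \<alpha>) = vertex (j + 1)" by (simp add: vertex_def cis_mult ring_distribs)
  moreover have "norm x *\<^sub>R cis (Arg x) = x" using rcis_cmod_Arg[of x] by (simp add: rcis_def scaleR_conv_of_real)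
  ultimately have "x = a *\<^sub>R vertex j + b *\<^sub>R vertex (j + 1)" by simp
  with ab show ?thesis by blast
qed

text \<open>A quarter turn maps the edge normals of a regular \<open>(4n + 2)\<close>-gon to its vertices, so the
  dual norm is a multiple of the rotated norm.\<close>

sublocale radon_plane polygon_norm "1 / cos \<alpha>"
proof
  show "1 / cos \<alpha> > 0" using cos_\<alpha>_pos by simp
  fix x y
  \<comment> \<open>The absolute value is covered by also using the antipodal vertex; extension to
    all \<open>y\<close> uses that the norm is additive in the sector of \<open>y\<close>.\<close>
  have *: "\<bar>cross2 x (vertex i)\<bar> \<le> cos \<alpha> * polygon_norm x" for i
    using polygon_norm_ge[of i x] polygon_norm_ge[of "i + (2 * int n + 1)" x]
    unfolding vertex_antipodal cross2_swap[of x "vertex i"] by (simp add: cross2_def)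
  obtain j a b where y: "a \<ge> 0" "b \<ge> 0" "y = a *\<^sub>R vertex j + b *\<^sub>R vertex (j + 1)"
    using ex_sector by blast
  have "\<bar>cross2 x y\<bar> \<le> a * \<bar>cross2 x (vertex j)\<bar> + b * \<bar>cross2 x (vertex (j + 1))\<bar>"
    using abs_triangle_ineq[of "a * cross2 x (vertex j)" "b * cross2 x (vertex (j + 1))"] y
    by (simp add: abs_mult)
  also have "\<dots> \<le> a * (cos \<alpha> * polygon_norm x) + b * (cos \<alpha> * polygon_norm x)"
    using y by (intro add_mono mult_left_mono *)
  also have "\<dots> = cos \<alpha> * (polygon_norm x * polygon_norm y)"
    unfolding y(3) polygon_norm_sector[OF y(1,2)] by (simp add: algebra_simps)
  finally show "1 / cos \<alpha> * \<bar>cross2 x y\<bar> \<le> polygon_norm x * polygon_norm y"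
    using cos_\<alpha>_pos by (simp add: field_simps)
  obtain j where "cross2 (vertex j) x = cos \<alpha> * polygon_norm x" using polygon_norm_attained by blast
  then show "\<exists>w. polygon_norm w = 1 \<and> 1 / cos \<alpha> * cross2 w x = polygon_norm x"
    using polygon_norm_vertex cos_\<alpha>_pos by (intro exI[of _ "vertex j"]) simp
qed

text \<open>A point of the ball lies in the triangle spanned by 0 and the two vertices of its
  sector, and 0 is the midpoint of antipodal vertices.\<close>

lemma convex_hull_vertices: "convex hull (range vertex) = {x. polygon_norm x \<le> 1}"
proof
  have "convex {x. polygon_norm x \<le> 1}"
  proof (rule convexI)
    fix x y and u v :: real
    assume "x \<in> {x. polygon_norm x \<le> 1}" "y \<in> {x. polygon_norm x \<le> 1}" "0 \<le> u" "0 \<le> v" "u + v = 1"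
    then show "u *\<^sub>R x + v *\<^sub>R y \<in> {x. polygon_norm x \<le> 1}"
      using N_triangle[of "u *\<^sub>R x" "v *\<^sub>R y"] convex_bound_le[of "polygon_norm x" 1 "polygon_norm y" u v] by simp
  qed
  then show "convex hull (range vertex) \<subseteq> {x. polygon_norm x \<le> 1}"
    by (intro hull_minimal) (auto simp: polygon_norm_vertex)
  show "{x. polygon_norm x \<le> 1} \<subseteq> convex hull (range vertex)"
  proof
    fix x assume x: "x \<in> {x. polygon_norm x \<le> 1}"
    obtain j a b where ab: "a \<ge> 0" "b \<ge> 0" "x = a *\<^sub>R vertex j + b *\<^sub>R vertex (j + 1)"
      using ex_sector by blast
    have in_hull: "vertex i \<in> convex hull (range vertex)" for i by (simp add: hull_inc)
    have "(1 / 2) *\<^sub>R vertex 0 + (1 / 2) *\<^sub>R vertex (0 + (2 * int n + 1)) \<in> convex hull (range vertex)"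
      by (intro convexD[OF convex_convex_hull] in_hull) auto
    then have "0 \<in> convex hull (range vertex)" unfolding vertex_antipodal by simp
    moreover have "a + b \<le> 1" using x polygon_norm_sector[OF ab(1,2)] ab(3) by simp
    moreover have "x = 0 + a *\<^sub>R (vertex j - 0) + b *\<^sub>R (vertex (j + 1) - 0)" using ab by simp
    ultimately have "x \<in> convex hull {0, vertex j, vertex (j + 1)}"
      unfolding convex_hull_3_alt using ab(1,2) by blast
    also have "\<dots> \<subseteq> convex hull (range vertex)"
      using \<open>0 \<in> _\<close> in_hull by (intro hull_minimal) auto
    finally show "x \<in> convex hull (range vertex)" .
  qed
qed

end

section \<open>Faces of the prism\<close>

text \<open>Reflection in the origin turns the integral into its negative. The set is first enclosed
  in a symmetric box, where the reflection rule applies.\<close>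

lemma integral_id_symmetric_set:
  fixes S :: "'a::euclidean_space set"
  assumes "bounded S" and sym: "\<And>x. - x \<in> S \<longleftrightarrow> x \<in> S"
  shows "integral S (\<lambda>x. x) = 0"
proof -
  obtain a where a: "S \<subseteq> cbox (- a) a" using bounded_subset_cbox_symmetric[OF assms(1)] .
  define f where "f x = (if x \<in> S then x else 0)" for x
  have "integral (cbox (- a) (- (- a))) (\<lambda>x. f (- x)) = integral (cbox (- a) a) f"
    by (rule integral_reflect)
  moreover have "f (- x) = - f x" for x by (simp add: f_def sym)
  ultimately have "- integral (cbox (- a) a) f = integral (cbox (- a) a) f" by simp
  then have "integral (cbox (- a) a) f = 0" by (simp add: neg_eq_iff_add_eq_0 flip: scaleR_2)
  moreover have "integral (cbox (- a) a) f = integral S (\<lambda>x. x)"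
    unfolding f_def using integral_restrict_Int[of "cbox (- a) a" S "\<lambda>x. x"] a
    by (simp add: Int_absorb2)
  ultimately show ?thesis by simp
qed

section \<open>Splitting points of the prism into base and height\<close>

definition base_proj :: "real^3 \<Rightarrow> complex"
  where "base_proj p = Complex (p $ 1) (p $ 2)"

definition prism_point :: "complex \<Rightarrow> real \<Rightarrow> real^3"
  where "prism_point x t = vector [Re x, Im x, t]"

lemma prism_point_simps [simp]:
  "base_proj (prism_point x t) = x" "prism_point x t $ 3 = t"
  "prism_point (base_proj p) (p $ 3) = p"
  by (simp_all add: base_proj_def prism_point_def vec_eq_iff forall_3)

lemma base_proj_simps [simp]:
  "base_proj (p + q) = base_proj p + base_proj q"
  "base_proj (p - q) = base_proj p - base_proj q"
  "base_proj (c *\<^sub>R p) = c *\<^sub>R base_proj p"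
  "base_proj (- p) = - base_proj p"
  "base_proj 0 = 0"
  by (simp_all add: base_proj_def complex_eq_iff)

lemma linear_prism_point: "linear (\<lambda>(x, t). prism_point x t)"
  by (rule linearI) (auto simp: prism_point_def vec_eq_iff forall_3)

lemma linear_horizontal_proj: "linear horizontal_proj"
  by (rule linearI) (simp_all add: horizontal_proj_def vec_eq_iff forall_2)

lemma horizontal_proj_eq_0_iff: "horizontal_proj p = 0 \<longleftrightarrow> base_proj p = 0"
  by (simp add: horizontal_proj_def base_proj_def vec_eq_iff forall_2 complex_eq_iff)

lemma prism_point_eqI: "base_proj p = base_proj q \<Longrightarrow> p $ 3 = q $ 3 \<Longrightarrow> p = q"
  by (simp add: base_proj_def vec_eq_iff forall_3)

context regular_polygon
begin

definition prism :: "(real^3) set"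
  where "prism = {p. polygon_norm (base_proj p) \<le> 1 \<and> \<bar>p $ 3\<bar> \<le> 1}"

definition prism_base :: "real \<Rightarrow> (real^3) set"
  where "prism_base s = prism \<inter> {p. p $ 3 = s}"

lemma prism_vertices_eq: "prism_vertices n = (\<lambda>(x, t). prism_point x t) ` (range vertex \<times> {-1, 1})"
proof -
  have vert: "prism_point (vertex (int j)) s
      = vector [cos (2 * pi * real j / real (4 * n + 2)), sin (2 * pi * real j / real (4 * n + 2)), s]" for j s
    by (simp add: prism_point_def vertex_def half_angle_def mult_ac)
  have "range vertex = (\<lambda>j. vertex (int j)) ` {0..4 * n + 1}"
  proof -
    have "{0..4 * int n + 1} = int ` {0..4 * n + 1}" by (simp add: image_int_atLeastAtMost)
    then show ?thesis by (simp add: range_vertex image_image)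
  qed
  then show ?thesis unfolding prism_vertices_def vert[symmetric] by force
qed

text \<open>The vertices are a linear image of a product, and convex hulls commute with products and
  linear images.\<close>

lemma convex_hull_prism_vertices: "convex hull (prism_vertices n) = prism"
proof -
  have "convex hull {-1, 1 :: real} = {-1..1}"
    by (simp add: closed_segment_eq_real_ivl flip: segment_convex_hull)
  then have "convex hull (prism_vertices n)
      = (\<lambda>(x, t). prism_point x t) ` ({x. polygon_norm x \<le> 1} \<times> {-1..1})"
    unfolding prism_vertices_eq convex_hull_linear_image[OF linear_prism_point, symmetric]
      convex_hull_Times convex_hull_vertices by simp
  also have "\<dots> = prism"
  proof
    show "prism \<subseteq> (\<lambda>(x, t). prism_point x t) ` ({x. polygon_norm x \<le> 1} \<times> {-1..1})"
    proof
      fix p assume "p \<in> prism"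
      then show "p \<in> (\<lambda>(x, t). prism_point x t) ` ({x. polygon_norm x \<le> 1} \<times> {-1..1})"
        by (intro image_eqI[of _ _ "(base_proj p, p $ 3)"]) (auto simp: prism_def)
    qed
  qed (auto simp: prism_def)
  finally show ?thesis .
qed

lemma convex_prism: "convex prism"
  unfolding convex_hull_prism_vertices[symmetric] by (rule convex_convex_hull)

lemma bounded_prism: "bounded prism"
  unfolding convex_hull_prism_vertices[symmetric] prism_vertices_eq
  by (rule finite_imp_bounded_convex_hull) (simp add: finite_range_vertex)

text \<open>Every vector can be scaled into the prism, which therefore spans the space and contains
  0.\<close>

lemma aff_dim_prism: "aff_dim prism = 3"
proof -
  have "p \<in> span prism" for p
  proof -
    define r where "r = 1 + polygon_norm (base_proj p) + \<bar>p $ 3\<bar>"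
    have r: "r > 0" "polygon_norm (base_proj p) \<le> r" "\<bar>p $ 3\<bar> \<le> r"
      using N_nonneg[of "base_proj p"] by (auto simp: r_def)
    have "inverse r *\<^sub>R p \<in> prism" using r by (simp add: prism_def field_simps abs_mult)
    then have "r *\<^sub>R (inverse r *\<^sub>R p) \<in> span prism" by (intro span_scale span_base)
    then show ?thesis using r by simp
  qed
  then have "span prism = UNIV" by blast
  then have "dim prism = 3" using dim_span[of prism] by simp
  moreover have "0 \<in> prism" by (simp add: prism_def)
  ultimately show ?thesis by (simp add: aff_dim_zero hull_inc)
qed

section \<open>The two bases as facets, and their centroids\<close>

lemma prism_base_subset: "prism_base s \<subseteq> prism"
  by (simp add: prism_base_def)

lemma prism_base_iff: "\<bar>s\<bar> = 1 \<Longrightarrow> p \<in> prism_base s \<longleftrightarrow> polygon_norm (base_proj p) \<le> 1 \<and> p $ 3 = s"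
  by (auto simp: prism_base_def prism_def)

lemma prism_base_face:
  assumes s: "\<bar>s\<bar> = 1"
  shows "prism_base s face_of prism"
proof -
  have s2: "s * s = 1" using s abs_mult_self_eq[of s] by simp
  have in_eq: "axis 3 s \<bullet> p = s * p $ 3" for p :: "real^3" by (simp add: inner_axis')
  have "prism \<inter> {p. axis 3 s \<bullet> p = 1} face_of prism"
  proof (rule face_of_Int_supporting_hyperplane_le[OF convex_prism])
    fix p assume "p \<in> prism"
    then have "\<bar>s * p $ 3\<bar> \<le> 1" using s by (simp add: abs_mult prism_def)
    then show "axis 3 s \<bullet> p \<le> 1" unfolding in_eq by linarith
  qed
  moreover have "s * t = 1 \<longleftrightarrow> t = s" for t using s2 s by (cases "s \<ge> 0") auto
  ultimately show ?thesis unfolding prism_base_def in_eq by simp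
qed

lemma convex_prism_base: "\<bar>s\<bar> = 1 \<Longrightarrow> convex (prism_base s)"
  using prism_base_face face_of_imp_convex by blast

text \<open>A proper face has smaller dimension, and it loses only one because the base together
  with 0 already has the prism in its affine hull.\<close>

lemma prism_base_facet:
  assumes s: "\<bar>s\<bar> = 1"
  shows "prism_base s facet_of prism"
proof -
  let ?T = "prism_base s"
  have axis_in: "prism_point 0 s \<in> ?T" using s by (simp add: prism_base_iff)
  have "0 \<in> prism - ?T" using s by (auto simp: prism_def prism_base_def)
  then have "aff_dim ?T < aff_dim prism"
    using face_of_aff_dim_lt[OF convex_prism prism_base_face[OF s]] by blast
  moreover have "aff_dim prism \<le> aff_dim ?T + 1"
  proof -
    have "prism \<subseteq> affine hull (insert 0 ?T)"
    proof
      fix p assume p: "p \<in> prism"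
      \<comment> \<open>The vertical projection of \<open>p\<close> to the base, corrected by a
        multiple of the centre of the base.\<close>
      have "p = prism_point (base_proj p) s + (p $ 3 / s - 1) *\<^sub>R prism_point 0 s"
        using s by (intro prism_point_eqI) (auto simp: left_diff_distrib)
      moreover have "prism_point (base_proj p) s \<in> ?T" using p s by (simp add: prism_base_iff prism_def)
      ultimately have "p \<in> span (insert 0 ?T)"
        using axis_in by (metis insertI2 span_add span_base span_scale)
      then show "p \<in> affine hull (insert 0 ?T)" by (simp add: affine_hull_span_0 hull_inc)
    qed
    then have "aff_dim prism \<le> aff_dim (insert 0 ?T)"
      using aff_dim_subset[of prism "affine hull (insert 0 ?T)"] by simp
    also have "\<dots> \<le> aff_dim ?T + 1" by (simp add: aff_dim_insert)
    finally show ?thesis .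
  qed
  ultimately show ?thesis
    using axis_in prism_base_face[OF s] by (auto simp: facet_of_def)
qed

text \<open>A horizontal facet is a face of one of the bases and has the same dimension, so it
  cannot be a proper face of it.\<close>

lemma horizontal_facet_of_prism_iff:
  "F horizontal_facet_of prism \<longleftrightarrow> F = prism_base 1 \<or> F = prism_base (-1)"
proof
  assume F: "F horizontal_facet_of prism"
  then have face: "F face_of prism" and dim: "aff_dim F = aff_dim prism - 1"
    by (auto simp: horizontal_facet_of_def facet_of_def)
  obtain s :: real where s: "s = 1 \<or> s = -1" "F \<subseteq> {p. p $ 3 = s}"
    using F by (auto simp: horizontal_facet_of_def)
  then have abs: "\<bar>s\<bar> = 1" by auto
  have "F \<subseteq> prism_base s" using s face_of_imp_subset[OF face] by (auto simp: prism_base_def)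
  then have "F face_of prism_base s" using face_of_subset[OF face] prism_base_subset by blast
  moreover have "aff_dim F = aff_dim (prism_base s)"
    using prism_base_facet[OF abs] dim by (simp add: facet_of_def)
  ultimately have "F = prism_base s"
    using face_of_aff_dim_lt[OF convex_prism_base[OF abs]] by force
  then show "F = prism_base 1 \<or> F = prism_base (-1)" using s by blast
next
  assume "F = prism_base 1 \<or> F = prism_base (-1)"
  then show "F horizontal_facet_of prism"
    using prism_base_facet[of 1] prism_base_facet[of "-1"]
    by (auto simp: horizontal_facet_of_def prism_base_def)
qed

text \<open>The projected base is bounded and symmetric about 0, so the integral vanishes whatever
  the area factor is.\<close>

lemma centroid_horizontal_proj_prism_base:
  assumes s: "\<bar>s\<bar> = 1"
  shows "centroid (horizontal_proj ` prism_base s) = 0"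
proof -
  let ?S = "horizontal_proj ` prism_base s"
  have "bounded ?S"
    using bounded_linear_image[of _ horizontal_proj] linear_horizontal_proj bounded_prism prism_base_subset
    by (meson bounded_subset linear_conv_bounded_linear)
  moreover have mem: "- x \<in> ?S" if "x \<in> ?S" for x
  proof -
    from that obtain p where p: "p \<in> prism_base s" "x = horizontal_proj p" by blast
    then have "prism_point (- base_proj p) s \<in> prism_base s" using s by (simp add: prism_base_iff)
    moreover have "- x = horizontal_proj (prism_point (- base_proj p) s)"
      by (simp add: p horizontal_proj_def prism_point_def base_proj_def vec_eq_iff forall_2)
    ultimately show ?thesis by blast
  qed
  moreover have "- x \<in> ?S \<longleftrightarrow> x \<in> ?S" for x using mem[of x] mem[of "- x"] by auto
  ultimately show ?thesis by (simp add: centroid_def integral_id_symmetric_set)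
qed

lemma is_centroid_prism_base_iff:
  assumes s: "\<bar>s\<bar> = 1"
  shows "is_centroid_of_horizontal_facet p (prism_base s) \<longleftrightarrow> base_proj p = 0 \<and> p $ 3 = s"
proof
  assume *: "is_centroid_of_horizontal_facet p (prism_base s)"
  have "affine hull prism_base s \<subseteq> {p. axis 3 1 \<bullet> p = s}"
    by (intro hull_minimal affine_hyperplane) (auto simp: prism_base_def inner_axis')
  with * show "base_proj p = 0 \<and> p $ 3 = s"
    unfolding is_centroid_of_horizontal_facet_def centroid_horizontal_proj_prism_base[OF s]
    by (auto simp: horizontal_proj_eq_0_iff inner_axis')
next
  assume "base_proj p = 0 \<and> p $ 3 = s"
  then show "is_centroid_of_horizontal_facet p (prism_base s)"
    using s unfolding is_centroid_of_horizontal_facet_def centroid_horizontal_proj_prism_base[OF s]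
    by (simp add: horizontal_proj_eq_0_iff hull_inc prism_base_iff)
qed

lemma ex_centroid_horizontal_facet_iff:
  "(\<exists>F. F horizontal_facet_of prism \<and> is_centroid_of_horizontal_facet p F)
    \<longleftrightarrow> base_proj p = 0 \<and> \<bar>p $ 3\<bar> = 1"
proof -
  have "(\<exists>F. F horizontal_facet_of prism \<and> is_centroid_of_horizontal_facet p F)
      \<longleftrightarrow> is_centroid_of_horizontal_facet p (prism_base 1)
        \<or> is_centroid_of_horizontal_facet p (prism_base (-1))"
    unfolding horizontal_facet_of_prism_iff by blast
  then show ?thesis by (simp add: is_centroid_prism_base_iff) linarith
qed

section \<open>The horizontal edges\<close>

text \<open>A face contains every segment of the prism that has one of its points in the open
  interior. At an intermediate height this gives a vertical segment in \<open>E\<close>; at a point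
  inside a base it gives the whole base, which has dimension 2.\<close>

lemma horizontal_edge_ofD:
  assumes E: "E horizontal_edge_of prism" and p: "p \<in> E"
  shows "polygon_norm (base_proj p) = 1 \<and> \<bar>p $ 3\<bar> = 1"
proof -
  from E have face: "E face_of prism" and dim: "aff_dim E = 1"
    and horizontal: "\<And>q r. q \<in> E \<Longrightarrow> r \<in> E \<Longrightarrow> q $ 3 = r $ 3"
    unfolding horizontal_edge_of_def edge_of_def by blast+
  have pB: "polygon_norm (base_proj p) \<le> 1" "\<bar>p $ 3\<bar> \<le> 1"
    using face_of_imp_subset[OF face] p by (auto simp: prism_def)
  have h1: "\<bar>p $ 3\<bar> = 1"
  proof (rule ccontr)
    assume "\<bar>p $ 3\<bar> \<noteq> 1"
    then have d: "1 - \<bar>p $ 3\<bar> > 0" using pB by simp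
    define e where "e = prism_point 0 (1 - \<bar>p $ 3\<bar>)"
    have "e \<noteq> 0" using d by (auto simp: e_def dest: arg_cong[of _ _ "\<lambda>p. p $ 3"])
    moreover have "p + e \<in> prism" "p - e \<in> prism" using pB by (auto simp: prism_def e_def)
    moreover have "p = midpoint (p + e) (p - e)" by (simp add: midpoint_def flip: scaleR_2)
    ultimately have "p \<in> open_segment (p + e) (p - e)"
      by (metis add_cancel_left_right diff_add_cancel midpoint_eq_endpoint(1) midpoint_in_open_segment add_left_cancel)
    then have "p + e \<in> E" using face_ofD[OF face] p \<open>p + e \<in> prism\<close> \<open>p - e \<in> prism\<close> by blast
    then have "p $ 3 = (p + e) $ 3" using horizontal p by blast
    then show False using d by (simp add: e_def)
  qed
  moreover have "polygon_norm (base_proj p) = 1"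
  proof (rule ccontr)
    assume "polygon_norm (base_proj p) \<noteq> 1"
    \<comment> \<open>Half the gap to the boundary: extending the segment from any \<open>q\<close>
      in the base beyond \<open>p\<close> by the factor \<open>d\<close> raises the norm by at most
      \<open>2 * d\<close> and stays in the prism.\<close>
    define d where "d = (1 - polygon_norm (base_proj p)) / 2"
    have d: "d > 0" "d < 1" using pB \<open>_ \<noteq> 1\<close> N_nonneg[of "base_proj p"] by (auto simp: d_def)
    have "q \<in> E" if q: "q \<in> prism_base (p $ 3)" for q
    proof (cases "q = p")
      case False
      define r where "r = p - d *\<^sub>R (q - p)"
      have Nq: "polygon_norm (base_proj q) \<le> 1" "q $ 3 = p $ 3" using q h1 by (auto simp: prism_base_iff)
      have "base_proj r = (1 + d) *\<^sub>R base_proj p + (- d) *\<^sub>R base_proj q"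
        by (simp add: r_def algebra_simps)
      then have "polygon_norm (base_proj r) \<le> (1 + d) * polygon_norm (base_proj p) + d * polygon_norm (base_proj q)"
        using N_triangle[of "(1 + d) *\<^sub>R base_proj p" "(- d) *\<^sub>R base_proj q"] d by simp
      also have "\<dots> \<le> polygon_norm (base_proj p) + d * 1 + d * 1"
        using mult_left_mono[OF pB(1), of d] mult_left_mono[OF Nq(1), of d] d
        unfolding ring_distribs by linarith
      also have "\<dots> = 1" by (simp add: d_def field_simps)
      finally have "polygon_norm (base_proj r) \<le> 1" .
      moreover have "r $ 3 = p $ 3" using Nq by (simp add: r_def)
      ultimately have "r \<in> prism" using h1 unfolding prism_def by simp
      moreover have "q \<in> prism" using q by (simp add: prism_base_def)
      moreover have "p \<in> open_segment r q"
      proof -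
        have "r - q = (1 + d) *\<^sub>R (p - q)" by (simp add: r_def algebra_simps)
        then have "r - q \<noteq> 0" using False d by simp
        moreover have "p = (1 - d / (1 + d)) *\<^sub>R r + (d / (1 + d)) *\<^sub>R q"
        proof -
          have "r + d *\<^sub>R q = (1 + d) *\<^sub>R p" by (simp add: r_def algebra_simps)
          then have "inverse (1 + d) *\<^sub>R (r + d *\<^sub>R q) = p" using d by simp
          moreover have "1 - d / (1 + d) = inverse (1 + d)" using d by (simp add: field_simps)
          ultimately show ?thesis by (simp add: scaleR_add_right divide_inverse mult.commute)
        qed
        ultimately show ?thesis using d unfolding in_segment(2) by (intro conjI exI[of _ "d / (1 + d)"]) simp_all
      qed
      ultimately show ?thesis using face_ofD[OF face] p by blast
    qed (use p in simp)
    then have "aff_dim (prism_base (p $ 3)) \<le> aff_dim E" by (intro aff_dim_subset) blast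
    then show False using prism_base_facet[OF h1] by (simp add: facet_of_def aff_dim_prism dim)
  qed
  ultimately show ?thesis by blast
qed

text \<open>The edge is cut out of the base by the functional of the side in the sector of
  \<open>p\<close>.\<close>

lemma ex_horizontal_edge:
  assumes p: "polygon_norm (base_proj p) = 1" "\<bar>p $ 3\<bar> = 1"
  shows "\<exists>E. E horizontal_edge_of prism \<and> p \<in> E"
proof -
  obtain j a b where ab: "a \<ge> 0" "b \<ge> 0" "base_proj p = a *\<^sub>R vertex j + b *\<^sub>R vertex (j + 1)"
    using ex_sector by blast
  then have sum: "a + b = 1" using polygon_norm_sector[OF ab(1,2)] p by metis
  define w where "w = vertex (j - int n)"
  \<comment> \<open>The vector \<open>w\<close> turned by a right angle, so that
    \<open>cross2 w\<close> becomes an inner product and describes a supporting hyperplane.\<close>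
  define c :: "real^3" where "c = vector [- Im w, Re w, 0]"
  have c: "c \<bullet> q = cross2 w (base_proj q)" for q
    by (simp add: c_def cross2_def base_proj_def inner_vec_def sum_3)
  define s where "s = p $ 3"
  define E where "E = prism_base s \<inter> (prism \<inter> {q. c \<bullet> q = cos \<alpha>})"
  have s: "\<bar>s\<bar> = 1" using p by (simp add: s_def)
  have "prism \<inter> {q. c \<bullet> q = cos \<alpha>} face_of prism"
  proof (rule face_of_Int_supporting_hyperplane_le[OF convex_prism])
    fix q assume "q \<in> prism"
    then have "cos \<alpha> * polygon_norm (base_proj q) \<le> cos \<alpha>"
      using cos_\<alpha>_pos mult_left_mono[of "polygon_norm (base_proj q)" 1 "cos \<alpha>"] by (simp add: prism_def)
    then show "c \<bullet> q \<le> cos \<alpha>" unfolding c w_def using polygon_norm_ge order_trans by blast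
  qed
  with prism_base_face[OF s] have E_face: "E face_of prism" unfolding E_def by (rule face_of_Int)
  have E_iff: "q \<in> E \<longleftrightarrow> polygon_norm (base_proj q) \<le> 1 \<and> q $ 3 = s \<and> cross2 w (base_proj q) = cos \<alpha>" for q
    using s by (auto simp: E_def prism_base_def prism_def c)
  have vE: "prism_point (vertex j) s \<in> E" "prism_point (vertex (j + 1)) s \<in> E"
    by (simp_all add: E_iff polygon_norm_vertex w_def cross2_vertex_conj)
  have "cross2 w (base_proj p) = a * cos \<alpha> + b * cos \<alpha>"
    unfolding ab(3) w_def cross2_simps cross2_vertex_conj ..
  then have "p \<in> E" using p sum by (simp add: E_iff s_def flip: distrib_right)
  moreover have "aff_dim E = 1"
  proof (rule antisym)
    \<comment> \<open>The centre of the base is not in \<open>E\<close>, so \<open>E\<close> is a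
      proper face of the base and has dimension at most 1; the two vertices give at least 1.\<close>
    have "E face_of prism_base s"
      using face_of_subset[OF E_face] prism_base_subset by (auto simp: E_def)
    moreover have "prism_point 0 s \<in> prism_base s - E"
      using s cos_\<alpha>_pos by (simp add: prism_base_iff E_iff)
    ultimately have "aff_dim E < aff_dim (prism_base s)"
      using face_of_aff_dim_lt[OF convex_prism_base[OF s]] by blast
    then show "aff_dim E \<le> 1" using prism_base_facet[OF s] by (simp add: facet_of_def aff_dim_prism)
    have "cross2 (vertex j) (vertex (j + 1)) \<noteq> 0" using sin_two_\<alpha>_pos by (simp add: cross2_vertex)
    then have "vertex j \<noteq> vertex (j + 1)" by auto
    then have "prism_point (vertex j) s \<noteq> prism_point (vertex (j + 1)) s"
      by (metis prism_point_simps(1))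
    then have "1 = aff_dim {prism_point (vertex j) s, prism_point (vertex (j + 1)) s}" by simp
    also have "\<dots> \<le> aff_dim E" using vE by (intro aff_dim_subset) auto
    finally show "1 \<le> aff_dim E" .
  qed
  ultimately show ?thesis using E_face by (auto simp: horizontal_edge_of_def edge_of_def E_iff)
qed

lemma ex_horizontal_edge_iff:
  "(\<exists>E. E horizontal_edge_of prism \<and> p \<in> E) \<longleftrightarrow> polygon_norm (base_proj p) = 1 \<and> \<bar>p $ 3\<bar> = 1"
  using horizontal_edge_ofD ex_horizontal_edge by blast

text \<open>The norm and the maximum \<open>m\<close> are both absolutely homogeneous and have the
  same unit ball. Normalising a nonzero vector by either one gives the two inequalities between
  them.\<close>

lemma radon_prism_coord:
  fixes coord :: "'z::real_normed_vector \<Rightarrow> real^3"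
  assumes lin: "linear coord" and bij: "bij coord" and ball: "coord ` cball 0 1 = prism"
  shows "radon_prism polygon_norm (1 / cos \<alpha>) (\<lambda>z. base_proj (coord z)) (\<lambda>z. coord z $ 3)"
proof (intro radon_prism.intro radon_prism_axioms.intro radon_plane_axioms)
  note lin_simps = linear_add[OF lin] linear_scale[OF lin] linear_0[OF lin]
  show "linear (\<lambda>z. base_proj (coord z))" "linear (\<lambda>z. coord z $ 3)"
    by (rule linearI; simp add: lin_simps)+
  fix x
  define m where "m z = max (polygon_norm (base_proj (coord z))) \<bar>coord z $ 3\<bar>" for z
  have m_scale: "m (c *\<^sub>R z) = \<bar>c\<bar> * m z" for c z
    by (simp add: m_def lin_simps abs_mult max_mult_distrib_left)
  have unit: "norm z \<le> 1 \<longleftrightarrow> m z \<le> 1" for z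
  proof -
    have "norm z \<le> 1 \<longleftrightarrow> coord z \<in> coord ` cball 0 1"
      using inj_image_mem_iff[OF bij_is_inj[OF bij], of z "cball 0 1"] by simp
    then show ?thesis by (simp add: ball prism_def m_def)
  qed
  have "norm x = m x"
  proof (cases "x = 0")
    case False
    have "m x \<noteq> 0"
    proof
      assume "m x = 0"
      then have "polygon_norm (base_proj (coord x)) = 0" "coord x $ 3 = 0"
        using N_nonneg[of "base_proj (coord x)"] unfolding m_def by linarith+
      then have "coord x = coord 0" by (intro prism_point_eqI) (simp_all add: lin_simps)
      then show False using False bij by (simp add: bij_def inj_eq)
    qed
    then have m: "m x > 0" unfolding m_def by linarith
    have "m (inverse (norm x) *\<^sub>R x) \<le> 1" using False by (simp flip: unit)
    then have "m x \<le> norm x" using False by (simp add: m_scale field_simps)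
    moreover have "norm (inverse (m x) *\<^sub>R x) \<le> 1" unfolding unit m_scale using m by simp
    then have "norm x \<le> m x" using m by (simp add: field_simps)
    ultimately show ?thesis by simp
  qed (simp add: m_def lin_simps)
  then show "norm x = max (polygon_norm (base_proj (coord x))) \<bar>coord x $ 3\<bar>" by (simp add: m_def)
next
  fix p t
  obtain x where "coord x = prism_point p t" using bij by (metis bij_pointE)
  then show "\<exists>x. base_proj (coord x) = p \<and> coord x $ 3 = t" by (intro exI[of _ x]) simp
qed

end

theorem theorem2p9:
  fixes n :: nat
    and coord :: "'z::banach \<Rightarrow> real^3"
    and z :: 'z
  assumes n: "n \<ge> 1"
    and dim3: "dim (UNIV :: 'z set) = 3"
    and polyhedral: "finite {e :: 'z. e extreme_point_of cball 0 1}"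
    and coord: "linear coord" "bij coord"
    and unit_ball: "coord ` cball 0 1 = convex hull (prism_vertices n)"
    and z: "z \<in> sphere 0 1"
  shows "(left_symmetric_point z \<longleftrightarrow>
            (\<exists>F. F horizontal_facet_of (coord ` cball 0 1) \<and>
                 is_centroid_of_horizontal_facet (coord z) F) \<or>
            (\<exists>x y. coord z = vector [x, y, 0])) \<and>
         (right_symmetric_point z \<longleftrightarrow>
            (\<exists>E. E horizontal_edge_of (coord ` cball 0 1) \<and> coord z \<in> E))"
proof -
  interpret regular_polygon n using n by unfold_locales
  have ball: "coord ` cball 0 1 = prism" using unit_ball convex_hull_prism_vertices by simp
  interpret Z: radon_prism polygon_norm "1 / cos half_angle" "\<lambda>z. base_proj (coord z)" "\<lambda>z. coord z $ 3"
    using coord ball by (rule radon_prism_coord)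
  have norm_z: "norm z = 1" using z by simp
  \<comment> \<open>On the unit sphere a vanishing plane part forces height 1 or -1, so such points
    are exactly the two centroids.\<close>
  then have "base_proj (coord z) = 0 \<Longrightarrow> \<bar>coord z $ 3\<bar> = 1" using Z.norm_eq[of z] by simp
  moreover have "(\<exists>x y. coord z = vector [x, y, 0]) \<longleftrightarrow> coord z $ 3 = 0"
    by (auto simp: vec_eq_iff forall_3)
  ultimately show ?thesis
    unfolding ball ex_centroid_horizontal_facet_iff ex_horizontal_edge_iff
    using Z.left_symmetric_iff[OF norm_z] Z.right_symmetric_iff[OF norm_z] by blast
qed

end
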